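(* Let $\Pi$ be a ground normal program over atoms $\mathcal{A}$, $A\subseteq\mathcal{A}$, and $\hat I$ an answer set of $\mathit{omit}(\Pi,A)$. Let $P=\mathcal{T}_{meta}[\Pi]\cup\mathcal{T}_P[\Pi]\cup\mathcal{T}_C[\Pi,\mathcal{A}]\cup\mathcal{T}_A[\mathcal{A}]\cup Q^{\overline{A}}_{\hat I}$. Then: (1) If $X$ is an answer set of $\Pi\cup Q^{\overline{A}}_{\hat I}$, then $X\cup\{\mathit{ko}(n_r)\mid r\in\Pi^c_A\}\cup\{\mathit{ap}(n_r)\mid r\in\Pi^X\}\cup\{\mathit{bl}(n_r)\mid r\in\Pi\setminus\Pi^X\}$ is an answer set of $P$. (2) If $Y$ is an answer set of $P$ with $Y\cap \mathit{AB}_A(\Pi)=\emptyset$, then $Y\cap\mathcal{A}$ is an answer set of $\Pi\cup Q^{\overline{A}}_{\hat I}$.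
   Context: A ground normal program $\Pi$ is a finite set of rules $r$: $\alpha_0\leftarrow\alpha_1,\dots,\alpha_m,\mathit{not}\ \alpha_{m+1},\dots,\mathit{not}\ \alpha_n$ with $\alpha_0$ an atom or $\bot$. $H(r)=\alpha_0$, $B^+(r)$, $B^-(r)$ positive/negative body atoms, $B^\pm(r)=B^+(r)\cup B^-(r)$, $B(r)$ the body; $\mathit{def}(\alpha,\Pi)=\{r\in\Pi\mid H(r)=\alpha\}$. $\Pi^X=\{r\in\Pi\mid X\models B(r)\}$. Answer sets: $X$ is an answer set iff it is a minimal model of the reduct w.r.t. $X$ (Gelfond–Lifschitz style, where $\mathit{not}\ \beta$ is replaced by $\top$ if $\beta\notin X$ and $\bot$ otherwise, and double negation $\mathit{not}\ \mathit{not}\ \beta$ by $\top$ if $\beta\in X$ and $\bot$ otherwise; for programs without double negation this coincides with $X$ being a minimal model of $\Pi^X$). A choice rule $\{\alpha\}\leftarrow B$ abbreviates $\alpha\leftarrow B,\mathit{not}\ \bar\alpha$ and $\bar\alpha\leftarrow B,\mathit{not}\ \alpha$ with fresh $\bar\alpha$, projected away from answer sets. For $A\subseteq\mathcal{A}$: $\mathit{omit}(r,A)$ is $r$ if $A\cap B^\pm(r)=\emptyset$ and $H(r)\notin A$; is $\{H(r)\}\leftarrow B^+(r)\setminus A,\mathit{not}\ (B^-(r)\setminus A)$ if $A\cap B^\pm(r)\neq\emptyset$ and $H(r)\notin A\cup\{\bot\}$; and no rule otherwise; $\mathit{omit}(\Pi,A)=\bigcup_r\mathit{omit}(r,A)$.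 $\overline{A}=\mathcal{A}\setminus A$ and $Q^{\overline{A}}_{\hat I}=\{\bot\leftarrow\mathit{not}\ \alpha\mid\alpha\in\hat I\}\cup\{\bot\leftarrow\alpha\mid\alpha\in\overline{A}\setminus\hat I\}$. Each rule $r\in\Pi$ has a unique name $n_r$; $\mathit{ap}(n_r),\mathit{bl}(n_r),\mathit{ko}(n_r),\mathit{ab}_p(n_r),\mathit{ab}_c(\alpha),\mathit{ab}_l(\alpha)$ are fresh atoms. $\Pi^c_A=\{r\in\Pi\mid B^\pm(r)\cap A\neq\emptyset, H(r)\notin A\}$. $\mathcal{T}_{meta}[\Pi]$ contains, for each $r\in\Pi$: $H(r)\leftarrow\mathit{ap}(n_r),\mathit{not}\ \mathit{ko}(n_r)$; $\mathit{ap}(n_r)\leftarrow B(r)$; $\mathit{bl}(n_r)\leftarrow\mathit{not}\ \alpha_1$ for each $\alpha_1\in B^+(r)$; $\mathit{bl}(n_r)\leftarrow\mathit{not}\ \mathit{not}\ \alpha_2$ for each $\alpha_2\in B^-(r)$. $\mathcal{T}_P[\Pi]$ contains, for each $r\in\Pi^c_A$: if $H(r)\neq\bot$, the fact $\mathit{ko}(n_r)$, the rule $\{H(r)\}\leftarrow\mathit{ap}(n_r)$, and $\mathit{ab}_p(n_r)\leftarrow\mathit{ap}(n_r),\mathit{not}\ H(r)$; if $H(r)=\bot$, the fact $\mathit{ko}(n_r)$ and $\mathit{ab}_p(n_r)\leftarrow\mathit{ap}(n_r)$. $\mathcal{T}_C[\Pi,\mathcal{A}]$ contains, for each $\alpha\in\mathcal{A}\setminus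 A$ with $\mathit{def}(\alpha,\Pi)=\{r_1,\dots,r_k\}$: $\{\alpha\}\leftarrow\mathit{bl}(n_{r_1}),\dots,\mathit{bl}(n_{r_k})$ and $\mathit{ab}_c(\alpha)\leftarrow\alpha,\mathit{bl}(n_{r_1}),\dots,\mathit{bl}(n_{r_k})$. $\mathcal{T}_A[\mathcal{A}]$ contains, for each $\alpha\in\mathcal{A}$: $\{\mathit{ab}_l(\alpha)\}\leftarrow\mathit{not}\ \mathit{ab}_c(\alpha)$ and $\alpha\leftarrow\mathit{ab}_l(\alpha)$. $\mathit{AB}_A(\Pi)=\{\mathit{ab}_p(n_r)\mid r\in\Pi, B^\pm(r)\cap A\neq\emptyset, H(r)\notin A\}\cup\{\mathit{ab}_c(\alpha)\mid\alpha\in\mathcal{A}\setminus A\}\cup\{\mathit{ab}_l(\alpha)\mid\alpha\in\mathcal{A}\}$. *)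

theory Defs
  imports Main
begin

text \<open>
  Ground rules \<open>h \<leftarrow> pos, not neg, not not dneg\<close>; the head \<open>None\<close> stands for \<open>\<bottom>\<close>.
  Double negation does not occur in normal programs, but the meta-program needs it.
\<close>

datatype 'a rule =
  Rule (head: "'a option") (pos: "'a set") (neg: "'a set") (dneg: "'a set")

definition body_atoms :: "'a rule \<Rightarrow> 'a set" where
  "body_atoms r = pos r \<union> neg r"

definition normal_program :: "'a set \<Rightarrow> 'a rule set \<Rightarrow> bool" where
  "normal_program At Pi \<longleftrightarrow>
     finite Pi \<and>
     (\<forall>r\<in>Pi. finite (pos r) \<and> finite (neg r) \<and> dneg r = {} \<and>
        set_option (head r) \<union> body_atoms r \<subseteq> At)"

definition rules_for :: "'a \<Rightarrow> 'a rule set \<Rightarrow> 'a rule set" where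
  "rules_for a Pi = {r \<in> Pi. head r = Some a}"

definition sat_body :: "'a set \<Rightarrow> 'a rule \<Rightarrow> bool" where
  "sat_body X r \<longleftrightarrow> pos r \<subseteq> X \<and> neg r \<inter> X = {} \<and> dneg r \<subseteq> X"

definition applicable :: "'a rule set \<Rightarrow> 'a set \<Rightarrow> 'a rule set" where
  "applicable Pi X = {r \<in> Pi. sat_body X r}"

definition model :: "'a set \<Rightarrow> 'a rule set \<Rightarrow> bool" where
  "model X Pi \<longleftrightarrow> (\<forall>r\<in>Pi. sat_body X r \<longrightarrow> (\<exists>a\<in>X. head r = Some a))"

text \<open>
  Rules in which some \<open>not \<beta>\<close> or \<open>not not \<beta>\<close> is replaced by \<open>\<bottom>\<close> are dropped from
  the reduct, and body literals replaced by \<open>\<top>\<close> are deleted.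
\<close>

definition reduct :: "'a rule set \<Rightarrow> 'a set \<Rightarrow> 'a rule set" where
  "reduct Pi X =
     {Rule (head r) (pos r) {} {} | r. r \<in> Pi \<and> neg r \<inter> X = {} \<and> dneg r \<subseteq> X}"

definition answer_set :: "'a rule set \<Rightarrow> 'a set \<Rightarrow> bool" where
  "answer_set Pi X \<longleftrightarrow>
     model X (reduct Pi X) \<and> (\<forall>X'. X' \<subset> X \<longrightarrow> \<not> model X' (reduct Pi X))"

text \<open>
  \<open>Choice a P N\<close> is the choice rule \<open>{a} \<leftarrow> P, not N\<close>. It is expanded over a vocabulary
  extended by one fresh complement atom \<open>Bar a\<close> for each atom \<open>a\<close>; these atoms are
  projected away from the answer sets.
\<close>

datatype 'a statement = Plain "'a rule" | Choice 'a "'a set" "'a set"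

datatype 'a ext_atom = Orig 'a | Bar 'a

fun expand :: "'a statement \<Rightarrow> 'a ext_atom rule set" where
  "expand (Plain r) =
     {Rule (map_option Orig (head r)) (Orig ` pos r) (Orig ` neg r) (Orig ` dneg r)}"
| "expand (Choice a P N) =
     {Rule (Some (Orig a)) (Orig ` P) (Orig ` N \<union> {Bar a}) {},
      Rule (Some (Bar a)) (Orig ` P) (Orig ` N \<union> {Orig a}) {}}"

definition choice_answer_set :: "'a statement set \<Rightarrow> 'a set \<Rightarrow> bool" where
  "choice_answer_set S X \<longleftrightarrow>
     (\<exists>Z. answer_set (\<Union>s\<in>S. expand s) Z \<and> X = {a. Orig a \<in> Z})"

definition omit_rule :: "'a rule \<Rightarrow> 'a set \<Rightarrow> 'a statement set" where
  "omit_rule r A =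
     (if A \<inter> body_atoms r = {} \<and> head r \<notin> Some ` A then {Plain r}
      else if A \<inter> body_atoms r \<noteq> {} \<and> head r \<notin> Some ` A \<union> {None}
      then {Choice (the (head r)) (pos r - A) (neg r - A)}
      else {})"

definition omit :: "'a rule set \<Rightarrow> 'a set \<Rightarrow> 'a statement set" where
  "omit Pi A = (\<Union>r\<in>Pi. omit_rule r A)"

text \<open>
  \<open>query S I\<close> is the set of constraints that fixes the truth values of the atoms in \<open>S\<close>
  to those given by \<open>I\<close>.
\<close>

definition query :: "'a set \<Rightarrow> 'a set \<Rightarrow> 'a rule set" where
  "query S I = {Rule None {} {a} {} | a. a \<in> I} \<union> {Rule None {a} {} {} | a. a \<in> S - I}"

text \<open>
  The vocabulary of the meta-program. Freshness of the auxiliary atoms is built into the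
  datatype; \<open>'n\<close> is the type of rule names, and \<open>nm\<close> below is the naming function.
\<close>

datatype ('a, 'n) meta_atom =
  Atm 'a | Ap 'n | Bl 'n | Ko 'n | AbP 'n | AbC 'a | AbL 'a

definition changed :: "'a rule set \<Rightarrow> 'a set \<Rightarrow> 'a rule set" where
  "changed Pi A = {r \<in> Pi. body_atoms r \<inter> A \<noteq> {} \<and> head r \<notin> Some ` A}"

definition T_meta ::
  "('a rule \<Rightarrow> 'n) \<Rightarrow> 'a rule set \<Rightarrow> ('a, 'n) meta_atom statement set" where
  "T_meta nm Pi =
     {Plain (Rule (map_option Atm (head r)) {Ap (nm r)} {Ko (nm r)} {}) | r. r \<in> Pi} \<union>
     {Plain (Rule (Some (Ap (nm r))) (Atm ` pos r) (Atm ` neg r) {}) | r. r \<in> Pi} \<union>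
     {Plain (Rule (Some (Bl (nm r))) {} {Atm a} {}) | r a. r \<in> Pi \<and> a \<in> pos r} \<union>
     {Plain (Rule (Some (Bl (nm r))) {} {} {Atm a}) | r a. r \<in> Pi \<and> a \<in> neg r}"

definition T_P ::
  "('a rule \<Rightarrow> 'n) \<Rightarrow> 'a rule set \<Rightarrow> 'a set \<Rightarrow> ('a, 'n) meta_atom statement set" where
  "T_P nm Pi A =
     {Plain (Rule (Some (Ko (nm r))) {} {} {}) | r. r \<in> changed Pi A} \<union>
     {Choice (Atm h) {Ap (nm r)} {} | r h. r \<in> changed Pi A \<and> head r = Some h} \<union>
     {Plain (Rule (Some (AbP (nm r))) {Ap (nm r)} {Atm h} {}) | r h.
        r \<in> changed Pi A \<and> head r = Some h} \<union>
     {Plain (Rule (Some (AbP (nm r))) {Ap (nm r)} {} {}) | r.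
        r \<in> changed Pi A \<and> head r = None}"

definition T_C ::
  "('a rule \<Rightarrow> 'n) \<Rightarrow> 'a rule set \<Rightarrow> 'a set \<Rightarrow> 'a set \<Rightarrow> ('a, 'n) meta_atom statement set"
  where
  "T_C nm Pi At A =
     {Choice (Atm a) ((\<lambda>r. Bl (nm r)) ` rules_for a Pi) {} | a. a \<in> At - A} \<union>
     {Plain (Rule (Some (AbC a)) ({Atm a} \<union> (\<lambda>r. Bl (nm r)) ` rules_for a Pi) {} {}) | a.
        a \<in> At - A}"

definition T_A :: "'a set \<Rightarrow> ('a, 'n) meta_atom statement set" where
  "T_A At =
     {Choice (AbL a) {} {AbC a} | a. a \<in> At} \<union>
     {Plain (Rule (Some (Atm a)) {AbL a} {} {}) | a. a \<in> At}"

definition AB ::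
  "('a rule \<Rightarrow> 'n) \<Rightarrow> 'a rule set \<Rightarrow> 'a set \<Rightarrow> 'a set \<Rightarrow> ('a, 'n) meta_atom set" where
  "AB nm Pi At A =
     {AbP (nm r) | r. r \<in> Pi \<and> body_atoms r \<inter> A \<noteq> {} \<and> head r \<notin> Some ` A} \<union>
     {AbC a | a. a \<in> At - A} \<union>
     {AbL a | a. a \<in> At}"

end

theory Submission
  imports Defs
begin

text \<open>
  Read choice rules as \<open>a \<leftarrow> P, not N, not not a\<close>. Given an answer set \<open>X\<close> of the queried
  program and a submodel \<open>Z'\<close> of the reduct of the meta-program, the atoms \<open>Atm a\<close> in \<open>Z'\<close>
  form a submodel of the reduct of the queried program: an applicable unchanged rule
  fires through its \<open>T_meta\<close> rule, a changed one through its choice rule, whose head \<open>X\<close> has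
  chosen. So they are all of \<open>X\<close>, and this forces the auxiliary atoms.

  Conversely, if \<open>Z\<close> is an answer set without abnormality atoms, then \<open>Ap\<close> marks exactly the
  applicable rules, and \<open>AbP\<close>, \<open>AbC\<close> and \<open>AbL\<close> exclude violated changed rules, choices of
  unsupported atoms, and atoms added by \<open>T_A\<close>. A proper submodel \<open>X'\<close> on the object level
  lifts to one of the meta-program by deleting from \<open>Z\<close> the atoms outside \<open>X'\<close> and the
  \<open>Ap\<close> atoms of rules whose positive body is no longer contained in \<open>X'\<close>.
\<close>

section \<open>Reducts, minimality and supportedness\<close>

text \<open>Negated literals are settled by \<open>X\<close> alone, so only positive bodies and
  heads are tested against \<open>Y\<close>. Later arguments can thus speak of the rules of
  \<open>Q\<close> instead of those of the reduct.\<close>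

lemma model_reduct_iff:
  "model Y (reduct Q X) \<longleftrightarrow>
     (\<forall>r\<in>Q. neg r \<inter> X = {} \<and> dneg r \<subseteq> X \<and> pos r \<subseteq> Y \<longrightarrow> (\<exists>a\<in>Y. head r = Some a))"
  unfolding model_def reduct_def sat_body_def by fastforce

lemma answer_set_alt:
  "answer_set Q X \<longleftrightarrow>
     model X (reduct Q X) \<and> (\<forall>Y. Y \<subseteq> X \<and> model Y (reduct Q X) \<longrightarrow> Y = X)"
  unfolding answer_set_def by blast

text \<open>An atom without an applicable rule could be removed: any body that holds after the
  removal held before, and its head is another atom of \<open>X\<close>. This contradicts
  minimality.\<close>

lemma answer_set_supported:
  assumes "answer_set Q X" and "a \<in> X"
  shows "\<exists>r\<in>Q. head r = Some a \<and> sat_body X r"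
proof (rule ccontr)
  assume "\<not> ?thesis"
  then have "model (X - {a}) (reduct Q X)"
    using assms(1) unfolding answer_set_def model_reduct_iff sat_body_def
    by (smt (verit, ccfv_threshold) Diff_iff Diff_subset empty_iff insert_iff option.inject subset_trans)
  then show False
    using assms unfolding answer_set_alt by blast
qed

lemma model_reduct_Un:
  "model Y (reduct (Q \<union> R) X) \<longleftrightarrow> model Y (reduct Q X) \<and> model Y (reduct R X)"
  unfolding model_reduct_iff by blast

section \<open>Eliminating choice rules\<close>

text \<open>
  Up to projection, a choice rule \<open>{a} \<leftarrow> P, not N\<close> acts like the single rule
  \<open>a \<leftarrow> P, not N, not not a\<close>, which needs no complement atom.
\<close>

fun unchoice :: "'a statement \<Rightarrow> 'a rule" where
  "unchoice (Plain r) = r"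
| "unchoice (Choice a P N) = Rule (Some a) P N {a}"

text \<open>In an answer set of the expansion that projects to \<open>X\<close>, the complement
  atoms are forced: they belong exactly to \<open>active_choices S X - X\<close>.\<close>

definition active_choices :: "'a statement set \<Rightarrow> 'a set \<Rightarrow> 'a set" where
  "active_choices S X = {a. \<exists>P N. Choice a P N \<in> S \<and> P \<subseteq> X \<and> N \<inter> X = {}}"

text \<open>Every set over the extended vocabulary has this form, and inclusion is componentwise, so
  original and complement atoms can be treated separately.\<close>

definition bar_extension :: "'a set \<Rightarrow> 'a set \<Rightarrow> 'a ext_atom set" where
  "bar_extension X B = Orig ` X \<union> Bar ` B"

lemma bar_extension_simps [simp]:
  "Orig a \<in> bar_extension X B \<longleftrightarrow> a \<in> X"
  "Bar a \<in> bar_extension X B \<longleftrightarrow> a \<in> B"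
  "Orig ` C \<subseteq> bar_extension X B \<longleftrightarrow> C \<subseteq> X"
  "Orig ` C \<inter> bar_extension X B = {} \<longleftrightarrow> C \<inter> X = {}"
  unfolding bar_extension_def by auto

lemma bar_extension_exhaust: obtains X B where "Z = bar_extension X B"
proof
  show "Z = bar_extension {a. Orig a \<in> Z} {a. Bar a \<in> Z}"
  proof (rule set_eqI)
    fix x show "x \<in> Z \<longleftrightarrow> x \<in> bar_extension {a. Orig a \<in> Z} {a. Bar a \<in> Z}"
      by (cases x) simp_all
  qed
qed

lemma bar_extension_subset_iff:
  "bar_extension X B \<subseteq> bar_extension X' B' \<longleftrightarrow> X \<subseteq> X' \<and> B \<subseteq> B'"
  unfolding bar_extension_def by auto

lemma bar_extension_eq_iff: "bar_extension X B = bar_extension X' B' \<longleftrightarrow> X = X' \<and> B = B'"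
  unfolding set_eq_subset bar_extension_subset_iff by blast

lemma ball_statement_iff:
  "(\<forall>s\<in>S. Q s) \<longleftrightarrow>
     (\<forall>r. Plain r \<in> S \<longrightarrow> Q (Plain r)) \<and> (\<forall>a P N. Choice a P N \<in> S \<longrightarrow> Q (Choice a P N))"
  by (metis statement.exhaust)

text \<open>Of the two rules of a choice, the one with head \<open>Orig a\<close> survives the
  reduct only if \<open>a \<notin> B\<close>, the one with head \<open>Bar a\<close> only if
  \<open>a \<notin> X\<close>. Each disjunction in the last line comes from one of them.\<close>

lemma model_reduct_expand_iff:
  "model (bar_extension Y C) (reduct (\<Union>s\<in>S. expand s) (bar_extension X B)) \<longleftrightarrow>
     (\<forall>r. Plain r \<in> S \<longrightarrow> neg r \<inter> X = {} \<and> dneg r \<subseteq> X \<and> pos r \<subseteq> Y \<longrightarrow>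
        (\<exists>a\<in>Y. head r = Some a)) \<and>
     (\<forall>a P N. Choice a P N \<in> S \<longrightarrow> N \<inter> X = {} \<and> P \<subseteq> Y \<longrightarrow>
        (a \<in> B \<or> a \<in> Y) \<and> (a \<in> X \<or> a \<in> C))"
proof -
  have choice: "(\<forall>r\<in>expand (Choice a P N). neg r \<inter> bar_extension X B = {} \<and>
        dneg r \<subseteq> bar_extension X B \<and> pos r \<subseteq> bar_extension Y C \<longrightarrow>
        (\<exists>x\<in>bar_extension Y C. head r = Some x)) \<longleftrightarrow>
      (N \<inter> X = {} \<and> P \<subseteq> Y \<longrightarrow> (a \<in> B \<or> a \<in> Y) \<and> (a \<in> X \<or> a \<in> C))" for a P N
    by auto
  have plain: "(\<forall>r\<in>expand (Plain r'). neg r \<inter> bar_extension X B = {} \<and>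
        dneg r \<subseteq> bar_extension X B \<and> pos r \<subseteq> bar_extension Y C \<longrightarrow>
        (\<exists>x\<in>bar_extension Y C. head r = Some x)) \<longleftrightarrow>
      (neg r' \<inter> X = {} \<and> dneg r' \<subseteq> X \<and> pos r' \<subseteq> Y \<longrightarrow> (\<exists>a\<in>Y. head r' = Some a))" for r'
    by (cases "head r'") simp_all
  show ?thesis
    unfolding model_reduct_iff ball_UN ball_statement_iff[of S] choice plain ..
qed

lemma model_reduct_unchoice_iff:
  "model Y (reduct (unchoice ` S) X) \<longleftrightarrow>
     (\<forall>r. Plain r \<in> S \<longrightarrow> neg r \<inter> X = {} \<and> dneg r \<subseteq> X \<and> pos r \<subseteq> Y \<longrightarrow>
        (\<exists>a\<in>Y. head r = Some a)) \<and>
     (\<forall>a P N. Choice a P N \<in> S \<longrightarrow> N \<inter> X = {} \<and> a \<in> X \<and> P \<subseteq> Y \<longrightarrow> a \<in> Y)"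
proof -
  have "model Y (reduct (unchoice ` S) X) \<longleftrightarrow>
      (\<forall>s\<in>S. neg (unchoice s) \<inter> X = {} \<and> dneg (unchoice s) \<subseteq> X \<and> pos (unchoice s) \<subseteq> Y \<longrightarrow>
        (\<exists>a\<in>Y. head (unchoice s) = Some a))"
    unfolding model_reduct_iff by simp
  then show ?thesis
    unfolding ball_statement_iff[of S] by simp
qed

text \<open>Submodels are carried over in both directions: forgetting complement atoms keeps a
  model, and so does adding all of \<open>B\<close>. Conversely, a submodel with original part
  \<open>X\<close> cannot lose any atom of \<open>B\<close>.\<close>

lemma answer_set_bar_extension_iff:
  fixes S :: "'a statement set" and X :: "'a set"
  defines "B \<equiv> active_choices S X - X"
  shows "answer_set (\<Union>s\<in>S. expand s) (bar_extension X B) \<longleftrightarrow> answer_set (unchoice ` S) X"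
proof -
  define E where "E = reduct (\<Union>s\<in>S. expand s) (bar_extension X B)"
  define U where "U = reduct (unchoice ` S) X"
  note E_iff = model_reduct_expand_iff[where S = S and X = X and B = B, folded E_def]
  note U_iff = model_reduct_unchoice_iff[where S = S and X = X, folded U_def]
  have B_iff: "a \<in> B \<longleftrightarrow> (\<exists>P N. Choice a P N \<in> S \<and> P \<subseteq> X \<and> N \<inter> X = {}) \<and> a \<notin> X" for a
    unfolding B_def active_choices_def by simp
  \<comment> \<open>The rule for \<open>a\<close> matters in \<open>U\<close> only if
    \<open>a \<in> X\<close>; then \<open>a \<notin> B\<close>, so the expanded choice demands
    \<open>a \<in> Y\<close>.\<close>
  have project: "model Y U" if "model (bar_extension Y C) E" for Y C
    using that unfolding E_iff U_iff B_iff by blast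
  \<comment> \<open>Here \<open>Y \<subseteq> X\<close> is essential: a choice whose body holds in
    \<open>Y\<close> is then active in \<open>X\<close>, so its atom lies in \<open>X\<close> or in
    \<open>B\<close>.\<close>
  have extend: "model (bar_extension Y B) E" if "model Y U" "Y \<subseteq> X" for Y
    unfolding E_iff
  proof (intro conjI[OF _ allI[OF allI[OF allI]]] impI, goal_cases)
    case 1
    then show ?case using that(1) unfolding U_iff by blast
  next
    case (2 a P N)
    then have "a \<notin> X \<longrightarrow> a \<in> B" using that(2) unfolding B_iff by blast
    moreover have "a \<in> X \<longrightarrow> a \<in> Y" using 2 that(1) unfolding U_iff by blast
    ultimately show ?case by blast
  qed
  have bars: "B \<subseteq> C" if "model (bar_extension X C) E" for C
    using that B_iff unfolding E_iff by (meson subsetI)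
  show ?thesis
    unfolding answer_set_alt E_def[symmetric] U_def[symmetric]
  proof (intro iffI conjI allI impI; elim conjE)
    assume "model (bar_extension X B) E"
    then show "model X U" by (rule project)
  next
    fix Y assume min: "\<forall>Z. Z \<subseteq> bar_extension X B \<and> model Z E \<longrightarrow> Z = bar_extension X B"
      and Y: "Y \<subseteq> X" "model Y U"
    have "bar_extension Y B \<subseteq> bar_extension X B"
      unfolding bar_extension_subset_iff using Y(1) by blast
    with min extend[OF Y(2,1)] have "bar_extension Y B = bar_extension X B" by blast
    then show "Y = X" unfolding bar_extension_eq_iff by blast
  next
    assume "model X U"
    then show "model (bar_extension X B) E" using extend by blast
  next
    fix Z assume min: "\<forall>Y. Y \<subseteq> X \<and> model Y U \<longrightarrow> Y = X"
      and Z: "Z \<subseteq> bar_extension X B" "model Z E"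
    obtain Y C where ZE: "Z = bar_extension Y C"
      by (rule bar_extension_exhaust)
    have sub: "Y \<subseteq> X" "C \<subseteq> B"
      using Z(1) unfolding ZE bar_extension_subset_iff by blast+
    have "Y = X" using min sub(1) project Z(2) unfolding ZE by blast
    moreover have "B \<subseteq> C" using bars Z(2) unfolding ZE \<open>Y = X\<close> .
    ultimately show "Z = bar_extension X B"
      using sub(2) unfolding ZE bar_extension_eq_iff by blast
  qed
qed

lemma choice_answer_set_iff:
  "choice_answer_set S X \<longleftrightarrow> answer_set (unchoice ` S) X"
proof
  assume "choice_answer_set S X"
  then obtain Z where Z: "answer_set (\<Union>s\<in>S. expand s) Z" and X: "X = {a. Orig a \<in> Z}"
    unfolding choice_answer_set_def by blast
  obtain B where ZE: "Z = bar_extension X B"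
    using X by (cases rule: bar_extension_exhaust[of Z]) simp
  \<comment> \<open>Only the second rule of an expanded choice can support \<open>Bar a\<close>, and
    its body contains \<open>not a\<close>.\<close>
  have "a \<in> active_choices S X - X" if "a \<in> B" for a
  proof -
    have "Bar a \<in> Z" unfolding ZE using that by simp
    from answer_set_supported[OF Z this] obtain s r where
      "s \<in> S" "r \<in> expand s" "head r = Some (Bar a)" "sat_body Z r" by blast
    then have "\<exists>P N. Choice a P N \<in> S \<and> P \<subseteq> X \<and> N \<inter> X = {} \<and> a \<notin> X"
      by (cases s) (simp_all add: sat_body_def ZE, elim disjE, auto)
    then show ?thesis unfolding active_choices_def by blast
  qed
  moreover have "a \<in> B" if "a \<in> active_choices S X - X" for a
    using Z that unfolding answer_set_def ZE model_reduct_expand_iff active_choices_def by blast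
  ultimately have "B = active_choices S X - X" by blast
  then show "answer_set (unchoice ` S) X"
    using Z unfolding ZE by (simp only: answer_set_bar_extension_iff)
next
  assume "answer_set (unchoice ` S) X"
  then have "answer_set (\<Union>s\<in>S. expand s) (bar_extension X (active_choices S X - X))"
    by (simp only: answer_set_bar_extension_iff)
  then show "choice_answer_set S X"
    unfolding choice_answer_set_def by force
qed

section \<open>The reducts of the query and of the meta-program\<close>

text \<open>A constraint on \<open>not a\<close> is decided by \<open>X\<close> when the reduct is
  formed, whereas one on \<open>a\<close> always survives and is tested in \<open>Y\<close>. Hence
  the two different sets on the right.\<close>

lemma model_reduct_query_iff:
  "model Y (reduct (query S I) X) \<longleftrightarrow> I \<subseteq> X \<and> Y \<inter> (S - I) = {}"
  unfolding model_reduct_iff query_def by (auto simp: set_eq_iff; force)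

lemma head_query: "r \<in> query S I \<Longrightarrow> head r = None"
  unfolding query_def by auto

lemma ball_image_iff: "(\<forall>x\<in>f ` S. Q x) \<longleftrightarrow> (\<forall>x\<in>S. Q (f x))"
  by blast

lemma ball_setcompr: "(\<forall>x\<in>{f a |a. R a}. Q x) \<longleftrightarrow> (\<forall>a. R a \<longrightarrow> Q (f a))"
  by blast

lemma ball_setcompr2: "(\<forall>x\<in>{f a b |a b. R a b}. Q x) \<longleftrightarrow> (\<forall>a b. R a b \<longrightarrow> Q (f a b))"
  by blast

lemma image_disjoint_iff: "f ` S \<inter> T = {} \<longleftrightarrow> (\<forall>a\<in>S. f a \<notin> T)"
  by blast

lemma Bex_map_option_eq_Some_iff:
  "(\<exists>b\<in>S. map_option f x = Some b) \<longleftrightarrow> (\<exists>a. x = Some a \<and> f a \<in> S)"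
  by auto

definition meta_program ::
  "('a rule \<Rightarrow> 'n) \<Rightarrow> 'a rule set \<Rightarrow> 'a set \<Rightarrow> 'a set \<Rightarrow> 'a set \<Rightarrow> ('a, 'n) meta_atom statement set"
  where
  "meta_program nm Pi At A I =
     T_meta nm Pi \<union> T_P nm Pi A \<union> T_C nm Pi At A \<union> T_A At \<union>
     Plain ` query (Atm ` (At - A)) (Atm ` I)"

text \<open>Each group of rules contributes its own conjuncts. In \<open>T_P\<close> the choice rule
  survives if \<open>Atm h \<in> X\<close> and the \<open>AbP\<close> rule otherwise, hence the
  conditional. \<open>T_C\<close> yields two conclusions under one premise.\<close>

lemma model_reduct_meta_iff:
  "model Y (reduct (unchoice ` meta_program nm Pi At A I) X) \<longleftrightarrow>
     (\<forall>r\<in>Pi. Ko (nm r) \<notin> X \<and> Ap (nm r) \<in> Y \<longrightarrow> (\<exists>h. head r = Some h \<and> Atm h \<in> Y)) \<and>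
     (\<forall>r\<in>Pi. (\<forall>a\<in>neg r. Atm a \<notin> X) \<and> (\<forall>a\<in>pos r. Atm a \<in> Y) \<longrightarrow> Ap (nm r) \<in> Y) \<and>
     (\<forall>r\<in>Pi. (\<exists>a\<in>pos r. Atm a \<notin> X) \<or> (\<exists>a\<in>neg r. Atm a \<in> X) \<longrightarrow> Bl (nm r) \<in> Y) \<and>
     (\<forall>r\<in>changed Pi A. Ko (nm r) \<in> Y) \<and>
     (\<forall>r\<in>changed Pi A. \<forall>h. head r = Some h \<and> Ap (nm r) \<in> Y \<longrightarrow>
        (if Atm h \<in> X then Atm h \<in> Y else AbP (nm r) \<in> Y)) \<and>
     (\<forall>r\<in>changed Pi A. head r = None \<and> Ap (nm r) \<in> Y \<longrightarrow> AbP (nm r) \<in> Y) \<and>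
     (\<forall>a\<in>At - A. (\<forall>r\<in>rules_for a Pi. Bl (nm r) \<in> Y) \<longrightarrow>
        (Atm a \<in> X \<longrightarrow> Atm a \<in> Y) \<and> (Atm a \<in> Y \<longrightarrow> AbC a \<in> Y)) \<and>
     (\<forall>a\<in>At. AbC a \<notin> X \<and> AbL a \<in> X \<longrightarrow> AbL a \<in> Y) \<and>
     (\<forall>a\<in>At. AbL a \<in> Y \<longrightarrow> Atm a \<in> Y) \<and>
     (\<forall>a\<in>I. Atm a \<in> X) \<and> (\<forall>a\<in>At - A - I. Atm a \<notin> Y)"
proof -
  have meta: "model Y (reduct (unchoice ` T_meta nm Pi) X) \<longleftrightarrow>
     (\<forall>r\<in>Pi. Ko (nm r) \<notin> X \<and> Ap (nm r) \<in> Y \<longrightarrow> (\<exists>h. head r = Some h \<and> Atm h \<in> Y)) \<and>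
     (\<forall>r\<in>Pi. (\<forall>a\<in>neg r. Atm a \<notin> X) \<and> (\<forall>a\<in>pos r. Atm a \<in> Y) \<longrightarrow> Ap (nm r) \<in> Y) \<and>
     (\<forall>r\<in>Pi. (\<exists>a\<in>pos r. Atm a \<notin> X) \<or> (\<exists>a\<in>neg r. Atm a \<in> X) \<longrightarrow> Bl (nm r) \<in> Y)"
    unfolding T_meta_def image_Un model_reduct_iff ball_Un ball_image_iff
    ball_setcompr ball_setcompr2
    by (simp add: image_disjoint_iff image_subset_iff Bex_map_option_eq_Some_iff) blast
  have P: "model Y (reduct (unchoice ` T_P nm Pi A) X) \<longleftrightarrow>
     (\<forall>r\<in>changed Pi A. Ko (nm r) \<in> Y) \<and>
     (\<forall>r\<in>changed Pi A. \<forall>h. head r = Some h \<and> Ap (nm r) \<in> Y \<longrightarrow>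
        (if Atm h \<in> X then Atm h \<in> Y else AbP (nm r) \<in> Y)) \<and>
     (\<forall>r\<in>changed Pi A. head r = None \<and> Ap (nm r) \<in> Y \<longrightarrow> AbP (nm r) \<in> Y)"
    unfolding T_P_def image_Un model_reduct_iff ball_Un ball_image_iff
    ball_setcompr ball_setcompr2
    by (simp add: image_disjoint_iff image_subset_iff) (auto split: if_splits)
  have C: "model Y (reduct (unchoice ` T_C nm Pi At A) X) \<longleftrightarrow>
     (\<forall>a\<in>At - A. (\<forall>r\<in>rules_for a Pi. Bl (nm r) \<in> Y) \<longrightarrow>
        (Atm a \<in> X \<longrightarrow> Atm a \<in> Y) \<and> (Atm a \<in> Y \<longrightarrow> AbC a \<in> Y))"
    unfolding T_C_def image_Un model_reduct_iff ball_Un ball_image_iff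
    ball_setcompr ball_setcompr2
    by (simp add: image_disjoint_iff image_subset_iff) (auto split: if_splits)
  have A: "model Y (reduct (unchoice ` T_A At) X) \<longleftrightarrow>
     (\<forall>a\<in>At. AbC a \<notin> X \<and> AbL a \<in> X \<longrightarrow> AbL a \<in> Y) \<and>
     (\<forall>a\<in>At. AbL a \<in> Y \<longrightarrow> Atm a \<in> Y)"
    unfolding T_A_def image_Un model_reduct_iff ball_Un ball_image_iff
    ball_setcompr ball_setcompr2
    by (simp add: image_disjoint_iff image_subset_iff) (auto split: if_splits)
  have Q: "model Y (reduct (unchoice ` Plain ` query (Atm ` (At - A)) (Atm ` I)) X) \<longleftrightarrow>
     (\<forall>a\<in>I. Atm a \<in> X) \<and> (\<forall>a\<in>At - A - I. Atm a \<notin> Y)"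
    unfolding image_image unchoice.simps image_ident model_reduct_query_iff by auto
  show ?thesis
    unfolding meta_program_def image_Un model_reduct_Un meta[unfolded image_Un] P C A Q by (simp only: conj_assoc)
qed

text \<open>Forward forms of single rules, cited as \<open>M(1)\<close> to \<open>M(11)\<close> in
  the main proof.\<close>

lemma model_reduct_metaD:
  assumes "model Y (reduct (unchoice ` meta_program nm Pi At A I) X)"
  shows "\<lbrakk>r \<in> Pi; Ko (nm r) \<notin> X; Ap (nm r) \<in> Y\<rbrakk> \<Longrightarrow> \<exists>h. head r = Some h \<and> Atm h \<in> Y"
    and "\<lbrakk>r \<in> Pi; \<And>a. a \<in> neg r \<Longrightarrow> Atm a \<notin> X; \<And>a. a \<in> pos r \<Longrightarrow> Atm a \<in> Y\<rbrakk> \<Longrightarrow> Ap (nm r) \<in> Y"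
    and "\<lbrakk>r \<in> Pi; a \<in> pos r; Atm a \<notin> X\<rbrakk> \<Longrightarrow> Bl (nm r) \<in> Y"
    and "\<lbrakk>r \<in> Pi; a \<in> neg r; Atm a \<in> X\<rbrakk> \<Longrightarrow> Bl (nm r) \<in> Y"
    and "r \<in> changed Pi A \<Longrightarrow> Ko (nm r) \<in> Y"
    and "\<lbrakk>r \<in> changed Pi A; head r = Some h; Ap (nm r) \<in> Y; Atm h \<in> X\<rbrakk> \<Longrightarrow> Atm h \<in> Y"
    and "\<lbrakk>r \<in> changed Pi A; head r = Some h; Ap (nm r) \<in> Y; Atm h \<notin> X\<rbrakk> \<Longrightarrow> AbP (nm r) \<in> Y"
    and "\<lbrakk>r \<in> changed Pi A; head r = None; Ap (nm r) \<in> Y\<rbrakk> \<Longrightarrow> AbP (nm r) \<in> Y"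
    and "\<lbrakk>a \<in> At - A; \<And>r. r \<in> rules_for a Pi \<Longrightarrow> Bl (nm r) \<in> Y; Atm a \<in> Y\<rbrakk> \<Longrightarrow> AbC a \<in> Y"
    and "a \<in> I \<Longrightarrow> Atm a \<in> X"
    and "a \<in> At - A - I \<Longrightarrow> Atm a \<notin> Y"
  using assms unfolding model_reduct_meta_iff by (simp_all, blast+)

section \<open>Correspondence between answer sets of the program and of its meta-program\<close>

theorem theorem19:
  fixes At A I :: "'a set"
    and Pi :: "'a rule set"
    and nm :: "'a rule \<Rightarrow> 'n"
    and P :: "('a, 'n) meta_atom statement set"
  assumes "normal_program At Pi"
    and "A \<subseteq> At"
    and "inj_on nm Pi"
    and "choice_answer_set (omit Pi A) I"
    and P_def: "P = T_meta nm Pi \<union> T_P nm Pi A \<union> T_C nm Pi At A \<union> T_A At \<union>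
                    Plain ` query (Atm ` (At - A)) (Atm ` I)"
  shows "(\<forall>X. answer_set (Pi \<union> query (At - A) I) X \<longrightarrow>
            choice_answer_set P
              (Atm ` X \<union> {Ko (nm r) | r. r \<in> changed Pi A}
                       \<union> {Ap (nm r) | r. r \<in> applicable Pi X}
                       \<union> {Bl (nm r) | r. r \<in> Pi - applicable Pi X})) \<and>
         (\<forall>Y. choice_answer_set P Y \<and> Y \<inter> AB nm Pi At A = {} \<longrightarrow>
            answer_set (Pi \<union> query (At - A) I) {a \<in> At. Atm a \<in> Y})"
proof -
  have P: "P = meta_program nm Pi At A I"
    unfolding P_def meta_program_def ..
  \<comment> \<open>Both directions are proved for \<open>?U\<close>;
    \<open>choice_answer_set_iff\<close> transfers them to \<open>P\<close> at the end.\<close>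
  let ?U = "unchoice ` P" and ?R = "Pi \<union> query (At - A) I"
  have normalD: "dneg r = {}" "set_option (head r) \<subseteq> At" "pos r \<subseteq> At" "neg r \<subseteq> At" if "r \<in> Pi" for r
    using assms(1) that unfolding normal_program_def body_atoms_def by auto
  have nm_eq: "nm r = nm s \<longleftrightarrow> r = s" if "r \<in> Pi" "s \<in> Pi" for r s
    using assms(3) that by (rule inj_on_eq_iff)
  have changed_sub: "r \<in> Pi" if "r \<in> changed Pi A" for r
    using that unfolding changed_def by simp
  have app_iff: "r \<in> applicable Pi X \<longleftrightarrow> r \<in> Pi \<and> pos r \<subseteq> X \<and> neg r \<inter> X = {}" for r X
    using normalD(1) unfolding applicable_def sat_body_def by auto
  have model_iff: "model Y (reduct ?R X) \<longleftrightarrow>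
      (\<forall>r\<in>Pi. neg r \<inter> X = {} \<and> pos r \<subseteq> Y \<longrightarrow> (\<exists>h. head r = Some h \<and> h \<in> Y)) \<and>
      I \<subseteq> X \<and> Y \<inter> (At - A - I) = {}" for X Y
    unfolding model_reduct_Un model_reduct_query_iff unfolding model_reduct_iff
    using normalD(1) by auto
  have part1: "answer_set ?U
              (Atm ` X \<union> {Ko (nm r) | r. r \<in> changed Pi A}
                       \<union> {Ap (nm r) | r. r \<in> applicable Pi X}
                       \<union> {Bl (nm r) | r. r \<in> Pi - applicable Pi X})"
    if X: "answer_set ?R X" for X
  proof -
    define Z where "Z = Atm ` X \<union> {Ko (nm r) | r. r \<in> changed Pi A}
                       \<union> {Ap (nm r) | r. r \<in> applicable Pi X}
                       \<union> {Bl (nm r) | r. r \<in> Pi - applicable Pi X}"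
    have Z_iff: "Atm a \<in> Z \<longleftrightarrow> a \<in> X" "AbP n \<notin> Z" "AbC a \<notin> Z" "AbL a \<notin> Z" for a n
      unfolding Z_def by auto
    have Z_nm: "Ko (nm r) \<in> Z \<longleftrightarrow> r \<in> changed Pi A" "Ap (nm r) \<in> Z \<longleftrightarrow> r \<in> applicable Pi X"
        "Bl (nm r) \<in> Z \<longleftrightarrow> r \<notin> applicable Pi X" if "r \<in> Pi" for r
      using that nm_eq changed_sub unfolding Z_def applicable_def by auto
    have hd: "\<exists>h. head r = Some h \<and> h \<in> X" if "r \<in> applicable Pi X" for r
      using X that unfolding answer_set_def model_iff app_iff by blast
    \<comment> \<open>Query constraints have no head, so the supporting rule comes from
      \<open>Pi\<close>.\<close>
    have supp: "\<exists>r\<in>rules_for a Pi. r \<in> applicable Pi X" if "a \<in> X" for a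
      using answer_set_supported[OF X that] head_query
      unfolding rules_for_def applicable_def by fastforce
    have "model Z (reduct ?U Z)"
      unfolding P model_reduct_meta_iff
    proof (intro conjI ballI allI impI, goal_cases)
      case (1 r)
      then show ?case using hd Z_iff(1) Z_nm(2) by blast
    next
      case (2 r)
      then show ?case using Z_iff(1) Z_nm(2) app_iff by blast
    next
      case (3 r)
      then show ?case using Z_iff(1) Z_nm(3) app_iff by blast
    next
      case (4 r)
      then show ?case using changed_sub Z_nm(1) by blast
    next
      case (5 r h)
      then have "h \<in> X" using hd changed_sub Z_nm(2) by (metis option.inject)
      then show ?case using Z_iff(1) by simp
    next
      case (6 r)
      then show ?case using hd changed_sub Z_nm(2) by (metis option.distinct(1))
    next
      \<comment> \<open>The applicable rule supporting \<open>a\<close> has no \<open>Bl\<close>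
        atom in \<open>Z\<close>, so \<open>AbC a\<close> is not derived.\<close>
      case (8 a)
      then show ?case using supp[of a] Z_iff(1) Z_nm(3) unfolding rules_for_def by blast
    next
      case (10 a)
      then show ?case using Z_iff(4) by simp
    qed (use X Z_iff(1) in \<open>auto simp: answer_set_def model_iff\<close>)
    moreover have "Z' = Z" if sub: "Z' \<subseteq> Z" and mod: "model Z' (reduct ?U Z)" for Z'
    proof -
      note M = model_reduct_metaD[OF mod[unfolded P]]
      define X' where "X' = {a. Atm a \<in> Z'}"
      have X'_sub: "X' \<subseteq> X"
        using sub Z_iff(1) unfolding X'_def by blast
      have "model X' (reduct ?R X)"
        unfolding model_iff
      proof (intro conjI ballI impI)
        fix r assume r: "r \<in> Pi" and body: "neg r \<inter> X = {} \<and> pos r \<subseteq> X'"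
        then have "r \<in> applicable Pi X" using X'_sub unfolding app_iff by blast
        then obtain h where h: "head r = Some h" "h \<in> X" using hd by blast
        have ap: "Ap (nm r) \<in> Z'"
          using M(2)[OF r] body unfolding Z_iff(1) X'_def by blast
        have "Atm h \<in> Z'"
        proof (cases "r \<in> changed Pi A")
          case True
          then show ?thesis using M(6) h ap Z_iff(1) by blast
        next
          case False
          then show ?thesis using M(1)[OF r] h(1) ap Z_nm(1)[OF r] by simp
        qed
        then show "\<exists>h. head r = Some h \<and> h \<in> X'" using h(1) unfolding X'_def by simp
      qed (use X X'_sub in \<open>auto simp: answer_set_def model_iff\<close>)
      with X'_sub      have XX: "X' = X"
        using X unfolding answer_set_alt by blast
      have atm: "Atm a \<in> Z' \<longleftrightarrow> a \<in> X" for a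
        using XX unfolding X'_def by blast
      have ko: "Ko (nm r) \<in> Z'" if "r \<in> changed Pi A" for r
        using M(5)[OF that] .
      have ap: "Ap (nm r) \<in> Z'" if "r \<in> applicable Pi X" for r
        using M(2)[of r] that unfolding app_iff atm Z_iff(1) by blast
      \<comment> \<open>The \<open>Bl\<close> rules have empty positive bodies, so \<open>Z\<close>
        alone forces their heads into \<open>Z'\<close>.\<close>
      have bl: "Bl (nm r) \<in> Z'" if "r \<in> Pi - applicable Pi X" for r
        using M(3,4)[of r] that unfolding Diff_iff app_iff Z_iff(1) by blast
      have "Z \<subseteq> Z'"
        unfolding Z_def using atm ko ap bl by blast
      then show ?thesis using sub by blast
    qed
    ultimately have "answer_set ?U Z"
      unfolding answer_set_alt by blast
    then show ?thesis unfolding Z_def .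
  qed
  have part2: "answer_set ?R {a \<in> At. Atm a \<in> Z}"
    if Z: "answer_set ?U Z" and AB: "Z \<inter> AB nm Pi At A = {}" for Z
  proof -
    define X where "X = {a. Atm a \<in> Z}"
    have noAB: "r \<in> changed Pi A \<Longrightarrow> AbP (nm r) \<notin> Z" "a \<in> At - A \<Longrightarrow> AbC a \<notin> Z" 
      "a \<in> At \<Longrightarrow> AbL a \<notin> Z" for r a
      using AB unfolding AB_def changed_def by blast+
    \<comment> \<open>Support bounds \<open>Z\<close> from above: inspecting which rules can have a
      given head yields \<open>XAt\<close>, \<open>ko\<close> and \<open>ap\<close>. For the last
      two, injectivity of \<open>nm\<close> identifies the rule.\<close>
    have supp: "\<exists>s\<in>P. head (unchoice s) = Some a \<and> sat_body Z (unchoice s)" if "a \<in> Z" for a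
      using answer_set_supported[OF Z that] by blast
    have XAt: "X \<subseteq> At"
    proof
      fix a assume "a \<in> X"
      then obtain s where s: "s \<in> P" "head (unchoice s) = Some (Atm a)"
        using supp unfolding X_def by blast
      then show "a \<in> At"
        using normalD(2) changed_sub unfolding P meta_program_def T_meta_def T_P_def T_C_def T_A_def query_def
        by fastforce
    qed
    have ko: "r \<in> changed Pi A" if Z_ko: "Ko (nm r) \<in> Z" and "r \<in> Pi" for r
    proof -
      obtain s where s: "s \<in> P" "head (unchoice s) = Some (Ko (nm r))"
        using supp[OF Z_ko] by blast
      then obtain r' where "r' \<in> changed Pi A" "nm r' = nm r"
        unfolding P meta_program_def T_meta_def T_P_def T_C_def T_A_def query_def by auto
      then show ?thesis using nm_eq changed_sub \<open>r \<in> Pi\<close> by blast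
    qed
    have ap: "r \<in> applicable Pi X" if Z_ap: "Ap (nm r) \<in> Z" and "r \<in> Pi" for r
    proof -
      obtain s where s: "s \<in> P" "head (unchoice s) = Some (Ap (nm r))" "sat_body Z (unchoice s)"
        using supp[OF Z_ap] by blast
      then obtain r' where "r' \<in> Pi" "nm r' = nm r" "Atm ` pos r' \<subseteq> Z" "Atm ` neg r' \<inter> Z = {}"
        unfolding P meta_program_def T_meta_def T_P_def T_C_def T_A_def query_def by (auto simp: sat_body_def)
      then show ?thesis using nm_eq \<open>r \<in> Pi\<close> unfolding app_iff X_def by blast
    qed
    have "model Z (reduct ?U Z)"
      using Z unfolding answer_set_def by blast
    note M = model_reduct_metaD[OF this[unfolded P]]
    have hd: "\<exists>h. head r = Some h \<and> h \<in> X" if r: "r \<in> applicable Pi X" for r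
    proof -
      have Pi: "r \<in> Pi" using r unfolding app_iff by blast
      have ap: "Ap (nm r) \<in> Z"
        using M(2)[OF Pi] r unfolding app_iff X_def by blast
      show ?thesis
      proof (cases "r \<in> changed Pi A")
        case True
        then have "AbP (nm r) \<notin> Z" by (rule noAB)
        then show ?thesis using M(7,8)[OF True] ap unfolding X_def by (cases "head r") auto
      next
        case False
        then have "Ko (nm r) \<notin> Z" using ko Pi by blast
        then show ?thesis using M(1) Pi ap unfolding X_def by blast
      qed
    qed
    have query: "I \<subseteq> X" "X \<inter> (At - A - I) = {}"
      using M(10,11) unfolding X_def by blast+
    have "model X (reduct ?R X)"
      unfolding model_iff using hd query app_iff by blast
    moreover have "X' = X" if sub: "X' \<subseteq> X" and mod: "model X' (reduct ?R X)" for X'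
    proof -
      define Z' where "Z' = Z - Atm ` (- X') - {Ap (nm r) | r. r \<in> Pi \<and> \<not> pos r \<subseteq> X'}"
      have Z'_sub: "Z' \<subseteq> Z" unfolding Z'_def by blast
      have Z'_iff: "Atm a \<in> Z' \<longleftrightarrow> a \<in> X'" "Bl n \<in> Z' \<longleftrightarrow> Bl n \<in> Z" "Ko n \<in> Z' \<longleftrightarrow> Ko n \<in> Z"
          "AbP n \<in> Z' \<longleftrightarrow> AbP n \<in> Z" "AbC a \<in> Z' \<longleftrightarrow> AbC a \<in> Z" "AbL a \<in> Z' \<longleftrightarrow> AbL a \<in> Z" for a n
        using sub unfolding Z'_def X_def by auto
      have Z'_nm: "Ap (nm r) \<in> Z' \<longleftrightarrow> Ap (nm r) \<in> Z \<and> pos r \<subseteq> X'" if "r \<in> Pi" for r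
        using that nm_eq unfolding Z'_def by auto
      \<comment> \<open>By \<open>ap\<close> the negative body of \<open>r\<close> is false in
        \<open>X\<close>, and by the choice of \<open>Z'\<close> the positive body lies in
        \<open>X'\<close>; so the submodel \<open>X'\<close> contains the head, whether or not
        \<open>r\<close> is changed.\<close>
      have hd': "\<exists>h. head r = Some h \<and> Atm h \<in> Z'" if "r \<in> Pi" "Ap (nm r) \<in> Z'" for r
      proof -
        have "neg r \<inter> X = {}" "pos r \<subseteq> X'"
          using that ap Z'_nm unfolding app_iff by blast+
        then show ?thesis using mod that(1) unfolding model_iff Z'_iff by blast
      qed
      have "model Z' (reduct ?U Z)"
        unfolding P model_reduct_meta_iff
      proof (intro conjI ballI allI impI, goal_cases)
        case (1 r)
        then show ?case using hd' by blast
      next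
        case (2 r)
        then show ?case using M(2)[of r] Z'_iff(1) Z'_nm sub unfolding X_def by blast
      next
        case (3 r)
        then show ?case using M(3,4)[of r] Z'_iff(2) by blast
      next
        case (4 r)
        then show ?case using M(5) Z'_iff(3) by blast
      next
        case (5 r h)
        then show ?case using hd'[of r] changed_sub[of r] Z'_sub by auto
      next
        case (6 r)
        then show ?case using hd' changed_sub by (metis option.distinct(1))
      next
        \<comment> \<open>The case is vacuous: an atom of \<open>Z\<close> with all its rules
          blocked would put \<open>AbC a\<close> into \<open>Z\<close>.\<close>
        case (7 a)
        then show ?case using M(9)[of a] noAB(2)[of a] Z'_iff(2) Z'_sub by blast
      next
        case (8 a)
        then show ?case using M(9)[of a] noAB(2)[of a] Z'_iff(2) Z'_sub by blast
      next
        case (9 a)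
        then show ?case using noAB(3) by blast
      next
        case (10 a)
        then show ?case using noAB(3) Z'_sub by blast
      next
        case (11 a)
        then show ?case using M(10) by blast
      next
        case (12 a)
        then show ?case using M(11) Z'_sub by blast
      qed
      then have "Z' = Z"
        using Z Z'_sub unfolding answer_set_alt by blast
      then show ?thesis
        using Z'_iff(1) unfolding X_def by blast
    qed
    ultimately have "answer_set ?R X"
      unfolding answer_set_alt by blast
    moreover have "{a \<in> At. Atm a \<in> Z} = X"
      using XAt unfolding X_def by blast
    ultimately show ?thesis by simp
  qed
  show ?thesis
    unfolding choice_answer_set_iff using part1 part2 by blast
qed

end
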